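(* Let $A,B\in\mathsf{ASM}(n)$ with $A\le B$ in strong order, and let $i\in[n-1]$. Then $\pi_i(A)\le\pi_i(B)$. Equivalently, if $I_A\subseteq I_B$, then $I_{\pi_i(A)}\subseteq I_{\pi_i(B)}$.
   Context: An $n\times n$ alternating sign matrix (ASM) is a matrix with entries in $\{-1,0,1\}$ whose nonzero entries in each row and each column alternate in sign and sum to $1$; $\mathsf{ASM}(n)$ is the set of these. The corner sum function is $\mathrm{rk}_A(i,j)=\sum_{a\le i,\,b\le j}A_{a,b}$. Strong order: $A\le B$ iff $\mathrm{rk}_A(i,j)\ge\mathrm{rk}_B(i,j)$ for all $i,j\in[n]$. Over a field $\kappa$, with $S=\kappa[z_{i,j}:i,j\in[n]]$ and $Z=(z_{i,j})$, the ASM ideal is $I_A=\sum_{i,j}I_{\mathrm{rk}_A(i,j)+1}(Z_{[i],[j]})$, where $I_k(Z_{[i],[j]})$ is generated by the $k$-minors of the upper-left $i\times j$ submatrix; $A\le B$ iff $I_A\subseteq I_B$. For $i\in[n-1]$, $\pi_i(A)$ is the strong-order minimum of $\{B\in\mathsf{ASM}(n):\mathrm{rk}_B(a,b)=\mathrm{rk}_A(a,b)\text{ for all }a\neq i\}$. *)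

theory Defs
  imports
    "HOL-Library.Poly_Mapping"
    "HOL-Library.Set_Algebras"
    "HOL-Algebra.Ideal"
    "Jordan_Normal_Form.Determinant"
    "Jordan_Normal_Form.DL_Submatrix"
begin

text \<open>
  Library matrices are indexed from 0, so the entry written $A_{a,b}$ with $a,b \in [n]$ is
  \<open>A $$ (a - 1, b - 1)\<close>, and likewise the variable $z_{a,b}$ is the variable with index
  \<open>(a - 1, b - 1)\<close>. The positions of corner sums, of upper-left submatrices and of the
  operators \<open>asm_pi n i\<close> are counted from 1.
\<close>

definition alternating_signs :: "nat \<Rightarrow> (nat \<Rightarrow> int) \<Rightarrow> bool" where
  "alternating_signs n x \<longleftrightarrow>
    (\<forall>p q. p < q \<and> q < n \<and> x p \<noteq> 0 \<and> x q \<noteq> 0 \<and> (\<forall>m. p < m \<and> m < q \<longrightarrow> x m = 0)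
      \<longrightarrow> sgn (x q) = - sgn (x p))"

definition ASM :: "nat \<Rightarrow> int mat set" where
  "ASM n = {A \<in> carrier_mat n n.
     (\<forall>a<n. \<forall>b<n. A $$ (a, b) \<in> {-1, 0, 1}) \<and>
     (\<forall>a<n. alternating_signs n (\<lambda>b. A $$ (a, b)) \<and> (\<Sum>b<n. A $$ (a, b)) = 1) \<and>
     (\<forall>b<n. alternating_signs n (\<lambda>a. A $$ (a, b)) \<and> (\<Sum>a<n. A $$ (a, b)) = 1)}"

definition corner_sum :: "int mat \<Rightarrow> nat \<Rightarrow> nat \<Rightarrow> int" where
  "corner_sum A i j = (\<Sum>a<i. \<Sum>b<j. A $$ (a, b))"

definition strong_le :: "nat \<Rightarrow> int mat \<Rightarrow> int mat \<Rightarrow> bool" where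
  "strong_le n A B \<longleftrightarrow> (\<forall>i\<in>{1..n}. \<forall>j\<in>{1..n}. corner_sum A i j \<ge> corner_sum B i j)"

definition asm_fibre :: "nat \<Rightarrow> nat \<Rightarrow> int mat \<Rightarrow> int mat set" where
  "asm_fibre n i A = {B \<in> ASM n.
     \<forall>a\<in>{1..n}. \<forall>b\<in>{1..n}. a \<noteq> i \<longrightarrow> corner_sum B a b = corner_sum A a b}"

definition asm_pi :: "nat \<Rightarrow> nat \<Rightarrow> int mat \<Rightarrow> int mat" where
  "asm_pi n i A =
     (THE B. B \<in> asm_fibre n i A \<and> (\<forall>C \<in> asm_fibre n i A. strong_le n B C))"

text \<open>
  The type of polynomials with coefficients in \<open>'k\<close> and variables indexed by all of
  \<open>nat \<times> nat\<close>; a polynomial maps exponent vectors to coefficients. The polynomial ring in the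
  entries of a generic $n \times n$ matrix is the subring \<open>generic_ring n\<close>, in which the
  ideals are formed.
\<close>

type_synonym 'k zpoly = "((nat \<times> nat) \<Rightarrow>\<^sub>0 nat) \<Rightarrow>\<^sub>0 'k"

definition zvar :: "nat \<Rightarrow> nat \<Rightarrow> 'k::field zpoly" where
  "zvar a b = Poly_Mapping.single (Poly_Mapping.single (a, b) 1) 1"

definition generic_ring :: "nat \<Rightarrow> 'k::field zpoly ring" where
  "generic_ring n =
     \<lparr>carrier = {p. \<forall>m \<in> Poly_Mapping.keys p. Poly_Mapping.keys m \<subseteq> {..<n} \<times> {..<n}},
      monoid.mult = (*), one = 1, zero = 0, add = (+)\<rparr>"

definition generic_matrix :: "nat \<Rightarrow> 'k::field zpoly mat" where
  "generic_matrix n = mat n n (\<lambda>(a, b). zvar a b)"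

definition corner_minors :: "nat \<Rightarrow> nat \<Rightarrow> nat \<Rightarrow> nat \<Rightarrow> 'k::field zpoly set" where
  "corner_minors n k i j =
     {det (submatrix (generic_matrix n) R C) | R C.
        R \<subseteq> {..<i} \<and> C \<subseteq> {..<j} \<and> card R = k \<and> card C = k}"

text \<open>
  The sum of ideals below is the elementwise sum of sets. The corner sums of an alternating
  sign matrix are nonnegative, so \<open>nat\<close> does not truncate.
\<close>

definition asm_ideal :: "nat \<Rightarrow> int mat \<Rightarrow> 'k::field zpoly set" where
  "asm_ideal n A =
     (\<Sum>(i, j) \<in> {1..n} \<times> {1..n}.
        genideal (generic_ring n) (corner_minors n (nat (corner_sum A i j) + 1) i j))"

lemma generic_ring_cring: "cring (generic_ring n :: 'k::field zpoly ring)"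
proof -
  let ?S = "carrier (generic_ring n :: 'k zpoly ring)"
  have S: "?S = {p. \<forall>m \<in> Poly_Mapping.keys p. Poly_Mapping.keys m \<subseteq> {..<n} \<times> {..<n}}"
    by (simp add: generic_ring_def)
  have plus: "p + q \<in> ?S" if "p \<in> ?S" "q \<in> ?S" for p q
    using that Poly_Mapping.keys_add[of p q] unfolding S by blast
  have uminus: "- p \<in> ?S" if "p \<in> ?S" for p
    using that unfolding S by (simp add: in_keys_iff)
  have times: "p * q \<in> ?S" if pq: "p \<in> ?S" "q \<in> ?S" for p q
    unfolding S
  proof (intro CollectI ballI)
    fix m assume "m \<in> Poly_Mapping.keys (p * q)"
    then obtain a b where "m = a + b" "a \<in> Poly_Mapping.keys p" "b \<in> Poly_Mapping.keys q"
      using keys_mult[of p q] by blast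
    then show "Poly_Mapping.keys m \<subseteq> {..<n} \<times> {..<n}"
      using pq Poly_Mapping.keys_add[of a b] unfolding S by blast
  qed
  have one: "1 \<in> ?S" and zero: "0 \<in> ?S"
    unfolding S by simp_all
  have ops [simp]: "x \<oplus>\<^bsub>generic_ring n\<^esub> y = x + y" "x \<otimes>\<^bsub>generic_ring n\<^esub> y = x * y"
      "\<zero>\<^bsub>generic_ring n\<^esub> = (0 :: 'k zpoly)" "\<one>\<^bsub>generic_ring n\<^esub> = (1 :: 'k zpoly)"
    for x y :: "'k zpoly"
    by (simp_all add: generic_ring_def)
  show ?thesis
  proof (rule cringI)
    show "abelian_group (generic_ring n :: 'k zpoly ring)"
    proof (rule abelian_groupI, unfold ops)
      fix x assume "x \<in> ?S"
      then show "\<exists>y\<in>?S. y + x = 0"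
        using uminus by (intro bexI[of _ "- x"]) simp_all
    qed (fact plus zero | rule add.assoc add.commute add_0)+
    show "comm_monoid (generic_ring n :: 'k zpoly ring)"
      by (rule comm_monoidI, unfold ops) (fact times one | rule mult.assoc mult_1 mult.commute)+
  qed (unfold ops, rule distrib_right)
qed

end

theory Submission
  imports Defs
begin

text \<open>
  Alternating sign matrices correspond to corner sum functions, whose steps all lie in $\{0,1\}$.
  Row $i$ of such a function is constrained only by rows $i-1$ and $i+1$, and its largest admissible
  value is $\min(r(i-1,b)+1,\,r(i+1,b))$. These are the corner sums of $\pi_i(A)$ in row $i$, and
  they depend monotonically on those of $A$.

  For the ideals it remains to see that $A \le B$ iff $I_A \subseteq I_B$. Laplace expansion puts
  larger minors into the ideal of smaller ones, which gives one direction. Conversely, if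
  $\mathrm{rk}_A(i,j) < \mathrm{rk}_B(i,j)$, let $k = \mathrm{rk}_A(i,j)+1$ and let $P$ be the
  antidiagonal of the lower right $k \times k$ block of $[i] \times [j]$. Set all variables outside
  $P$ to $0$: the minor on that block survives, whereas all generators of $I_B$ die, since $P$ meets
  $[a] \times [b]$ in at most $\mathrm{rk}_B(a,b)$ positions because corner sums are 1-Lipschitz.
\<close>

section \<open>Corner sum functions of alternating sign matrices\<close>

lemma corner_sum_0 [simp]: "corner_sum A 0 j = 0" "corner_sum A i 0 = 0"
  by (simp_all add: corner_sum_def)

lemma corner_sum_Suc_row: "corner_sum A (Suc i) j = corner_sum A i j + (\<Sum>b<j. A $$ (i, b))"
  by (simp add: corner_sum_def)

lemma corner_sum_Suc_col: "corner_sum A i (Suc j) = corner_sum A i j + (\<Sum>a<i. A $$ (a, j))"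
  by (simp add: corner_sum_def sum.distrib)

lemma corner_sum_entry:
  "A $$ (a, b) = corner_sum A (Suc a) (Suc b) - corner_sum A a (Suc b)
     - corner_sum A (Suc a) b + corner_sum A a b"
  by (simp add: corner_sum_Suc_row)

lemma eq_mat_if_corner_sum_eq:
  assumes "A \<in> carrier_mat n n" "B \<in> carrier_mat n n"
    and eq: "\<And>i j. i \<in> {1..n} \<Longrightarrow> j \<in> {1..n} \<Longrightarrow> corner_sum A i j = corner_sum B i j"
  shows "A = B"
proof (rule eq_matI)
  have eq': "corner_sum A i j = corner_sum B i j" if "i \<le> n" "j \<le> n" for i j
    using eq[of i j] that by (cases "i = 0"; cases "j = 0") auto
  fix a b assume "a < dim_row B" "b < dim_col B"
  then show "A $$ (a, b) = B $$ (a, b)"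
    using assms(2) by (simp add: corner_sum_entry eq')
qed (use assms in auto)

text \<open>The nonzero entries read \<open>e, -e, e, ...\<close>, so every partial sum is
  \<open>0\<close> or \<open>e\<close>, and the total \<open>1\<close> forces
  \<open>e = 1\<close>.\<close>

lemma alternating_partial_sums:
  fixes x :: "nat \<Rightarrow> int"
  assumes x: "\<forall>b<n. x b \<in> {-1, 0, 1}" and alt: "alternating_signs n x"
    and total: "(\<Sum>b<n. x b) = 1" and "m \<le> n"
  shows "(\<Sum>b<m. x b) \<in> {0, 1}"
proof -
  \<comment> \<open>The first nonzero entry. Were all entries below \<open>n\<close> zero, this
    value would be meaningless, but the total \<open>1\<close> excludes that.\<close>
  define e where "e = x (LEAST b. x b \<noteq> 0)"
  \<comment> \<open>\<open>p\<close> is the last nonzero position before \<open>m\<close>; whether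
    its entry is \<open>e\<close> or \<open>-e\<close> fixes the partial sum.\<close>
  have inv: "(\<forall>b<m. x b = 0) \<or>
      (\<exists>p<m. x p \<noteq> 0 \<and> (x p = e \<or> x p = - e) \<and> (\<forall>q. p < q \<and> q < m \<longrightarrow> x q = 0) \<and>
        (\<Sum>b<m. x b) = (if x p = e then e else 0))" if "m \<le> n" for m
    using that
  proof (induction m)
    case 0
    then show ?case by simp
  next
    case (Suc m)
    consider (zero) "\<forall>b<m. x b = 0"
      | (last) p where "p < m" "x p \<noteq> 0" "x p = e \<or> x p = - e"
          "\<forall>q. p < q \<and> q < m \<longrightarrow> x q = 0" "(\<Sum>b<m. x b) = (if x p = e then e else 0)"
      using Suc by (meson Suc_leD)
    then show ?case
    proof cases
      case zero
      show ?thesis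
      proof (cases "x m = 0")
        case True
        with zero show ?thesis by (simp add: less_Suc_eq)
      next
        case False
        with zero have "(LEAST b. x b \<noteq> 0) = m"
          by (intro Least_equality) (metis linorder_not_less)+
        then have "x m = e" by (simp add: e_def)
        moreover have "(\<Sum>b<m. x b) = 0" using zero by simp
        ultimately show ?thesis
          using False by (intro disjI2 exI[of _ m]) simp
      qed
    next
      case last
      show ?thesis
      proof (cases "x m = 0")
        case True
        with last show ?thesis
          by (intro disjI2 exI[of _ p]) (auto simp add: less_Suc_eq simp del: if_split)
      next
        case nz: False
        have "sgn (x m) = - sgn (x p)"
          using alt last(1,2,4) nz Suc.prems unfolding alternating_signs_def by simp
        moreover have "x m \<in> {-1, 0, 1}" "x p \<in> {-1, 0, 1}"
          using x Suc.prems last(1) by auto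
        ultimately have "x m = - x p"
          using nz last(2) by auto
        then have "(\<Sum>b<Suc m. x b) = (if x m = e then e else 0)" "x m = e \<or> x m = - e"
          using last(2,3,5) by auto
        then show ?thesis
          using nz by (intro disjI2 exI[of _ m]) simp
      qed
    qed
  qed
  have val: "(\<Sum>b<m. x b) = 0 \<or> (\<Sum>b<m. x b) = e" if "m \<le> n" for m
    using inv[OF that] by (metis lessThan_iff sum.neutral)
  show ?thesis
    using val[of n] val[OF \<open>m \<le> n\<close>] total by simp
qed

text \<open>A sequence confined to \<open>{0, 1}\<close> can only rise from \<open>0\<close> and
  fall from \<open>1\<close>, so its rises and falls alternate.\<close>

lemma alternating_if_partial_sums:
  fixes x :: "nat \<Rightarrow> int"
  assumes S: "\<And>m. m \<le> n \<Longrightarrow> (\<Sum>b<m. x b) \<in> {0, 1}"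
  shows "\<forall>b<n. x b \<in> {-1, 0, 1}" and "alternating_signs n x"
proof -
  show "\<forall>b<n. x b \<in> {-1, 0, 1}"
  proof (intro allI impI)
    fix b assume "b < n"
    then show "x b \<in> {-1, 0, 1}" using S[of b] S[of "Suc b"] by auto
  qed
  show "alternating_signs n x"
    unfolding alternating_signs_def
  proof (intro allI impI, elim conjE)
    fix p q assume pq: "p < q" "q < n" "x p \<noteq> 0" "x q \<noteq> 0" "\<forall>m. p < m \<and> m < q \<longrightarrow> x m = 0"
    \<comment> \<open>The partial sum is constant between consecutive nonzero entries, so the step
      at \<open>q\<close> starts where the step at \<open>p\<close> ended.\<close>
    have "(\<Sum>b<q. x b) = (\<Sum>b<Suc p. x b)"
      using pq by (intro sum.mono_neutral_right) auto
    then show "sgn (x q) = - sgn (x p)"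
      using S[of p] S[of "Suc p"] S[of "Suc q"] pq by auto
  qed
qed

text \<open>Vertical steps of the corner sum are partial row sums and horizontal steps are partial
  column sums, so the two preceding lemmas turn sign conditions into step conditions. The boundary
  values carry the row and column totals.\<close>

lemma ASM_iff_corner_sum:
  "A \<in> ASM n \<longleftrightarrow> A \<in> carrier_mat n n \<and>
     (\<forall>a<n. \<forall>b\<le>n. corner_sum A (Suc a) b - corner_sum A a b \<in> {0, 1}) \<and>
     (\<forall>a\<le>n. \<forall>b<n. corner_sum A a (Suc b) - corner_sum A a b \<in> {0, 1}) \<and>
     (\<forall>a\<le>n. corner_sum A a n = int a) \<and> (\<forall>b\<le>n. corner_sum A n b = int b)"
  (is "_ \<longleftrightarrow> ?R")
proof
  assume A: "A \<in> ASM n"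
  have "corner_sum A a n = int a" if "a \<le> n" for a
    using that A by (induction a) (auto simp: ASM_def corner_sum_Suc_row)
  moreover have "corner_sum A n b = int b" if "b \<le> n" for b
    using that A by (induction b) (auto simp: ASM_def corner_sum_Suc_col)
  moreover have "(\<Sum>b<j. A $$ (a, b)) \<in> {0, 1}" if "a < n" "j \<le> n" for a j
    using A that by (intro alternating_partial_sums[of n]) (auto simp: ASM_def)
  moreover have "(\<Sum>a<i. A $$ (a, b)) \<in> {0, 1}" if "b < n" "i \<le> n" for b i
    using A that by (intro alternating_partial_sums[of n]) (auto simp: ASM_def)
  ultimately show ?R
    using A by (simp add: corner_sum_Suc_row corner_sum_Suc_col) (simp add: ASM_def)
next
  assume R: ?R
  have row: "(\<Sum>b<j. A $$ (a, b)) \<in> {0, 1}" if "a < n" "j \<le> n" for a j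
    using R that by (simp add: corner_sum_Suc_row)
  have col: "(\<Sum>a<i. A $$ (a, b)) \<in> {0, 1}" if "b < n" "i \<le> n" for b i
    using R that by (simp add: corner_sum_Suc_col)
  have "(\<Sum>b<n. A $$ (a, b)) = 1" if "a < n" for a
    using R that corner_sum_Suc_row[of A a n] by simp
  moreover have "(\<Sum>a<n. A $$ (a, b)) = 1" if "b < n" for b
    using R that corner_sum_Suc_col[of A n b] by simp
  moreover have "A $$ (a, b) \<in> {-1, 0, 1}" if "a < n" "b < n" for a b
    using alternating_if_partial_sums(1)[OF row] that by blast
  moreover have "alternating_signs n (\<lambda>b. A $$ (a, b))" if "a < n" for a
    using row[OF that] by (rule alternating_if_partial_sums(2))
  moreover have "alternating_signs n (\<lambda>a. A $$ (a, b))" if "b < n" for b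
    using col[OF that] by (rule alternating_if_partial_sums(2))
  ultimately show "A \<in> ASM n"
    using R unfolding ASM_def by simp
qed

text \<open>On the way from \<open>(a, b)\<close> to \<open>(i, j)\<close>, each step down or right
  adds at most \<open>1\<close> and steps up or left add nothing; truncated subtraction counts only
  the former.\<close>

lemma corner_sum_lipschitz:
  assumes A: "A \<in> ASM n" and n: "i \<le> n" "j \<le> n" "a \<le> n" "b \<le> n"
  shows "corner_sum A i j \<le> corner_sum A a b + int (i - a) + int (j - b)"
proof -
  have one_dim: "f p \<le> f q + int (p - q)"
    if step: "\<And>m. m < n \<Longrightarrow> f (Suc m) - f m \<in> {0, 1}" and pq: "p \<le> n" "q \<le> n"
    for f :: "nat \<Rightarrow> int" and p q
  proof (cases "p \<le> q")
    case True
    then show ?thesis using pq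
    proof (induction rule: dec_induct)
      case (step m)
      then show ?case using that(1)[of m] by auto
    qed simp
  next
    case False
    then have "q \<le> p" by simp
    then show ?thesis using pq
    proof (induction rule: dec_induct)
      case (step m)
      then show ?case using that(1)[of m] by auto
    qed simp
  qed
  have "corner_sum A i j \<le> corner_sum A a j + int (i - a)"
    by (rule one_dim[of "\<lambda>m. corner_sum A m j"]) (use A n in \<open>auto simp: ASM_iff_corner_sum\<close>)
  moreover have "corner_sum A a j \<le> corner_sum A a b + int (j - b)"
    by (rule one_dim) (use A n in \<open>auto simp: ASM_iff_corner_sum\<close>)
  ultimately show ?thesis by simp
qed

text \<open>The entries are mixed second differences of \<open>r\<close>, so both sums telescope.
  This realises a prescribed corner sum function by a matrix.\<close>

lemma corner_sum_mat:
  fixes r :: "nat \<Rightarrow> nat \<Rightarrow> int"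
  assumes "\<And>j. r 0 j = 0" "\<And>i. r i 0 = 0" "i \<le> n" "j \<le> n"
  shows "corner_sum (mat n n (\<lambda>(a, b). r (Suc a) (Suc b) - r a (Suc b) - r (Suc a) b + r a b)) i j
    = r i j" (is "corner_sum ?M i j = _")
  using \<open>i \<le> n\<close>
proof (induction i)
  case (Suc i)
  have "(\<Sum>b<j. ?M $$ (i, b)) = (\<Sum>b<j. (r (Suc i) (Suc b) - r i (Suc b)) - (r (Suc i) b - r i b))"
    using Suc.prems \<open>j \<le> n\<close> by (intro sum.cong) auto
  also have "\<dots> = r (Suc i) j - r i j"
    by (subst sum_lessThan_telescope) (simp add: assms)
  finally show ?case
    using Suc by (simp add: corner_sum_Suc_row)
qed (simp add: assms)

section \<open>The operators \<open>asm_pi\<close> in terms of corner sums\<close>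

lemma asm_pi_corner_sum:
  assumes A: "A \<in> ASM n" and i: "i \<in> {1..n-1}" and "a \<in> {1..n}" "b \<in> {1..n}"
  shows "corner_sum (asm_pi n i A) a b =
      (if a = i then min (corner_sum A (i - 1) b + 1) (corner_sum A (i + 1) b)
       else corner_sum A a b)"
proof -
  define r where "r a b = (if a = i then min (corner_sum A (i - 1) b + 1) (corner_sum A (i + 1) b)
       else corner_sum A a b)" for a b
  define M where "M = mat n n (\<lambda>(a, b). r (Suc a) (Suc b) - r a (Suc b) - r (Suc a) b + r a b)"
  obtain p where p: "i = Suc p" "Suc p < n"
    using i by (cases i) auto
  have M: "corner_sum M a b = r a b" if "a \<le> n" "b \<le> n" for a b
    unfolding M_def by (rule corner_sum_mat) (use that p in \<open>auto simp: r_def\<close>)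
  have step: "corner_sum A (Suc a) b - corner_sum A a b = 0 \<or> corner_sum A (Suc a) b - corner_sum A a b = 1"
    if "a < n" "b \<le> n" for a b
    using A that unfolding ASM_iff_corner_sum by simp
  have step': "corner_sum A a (Suc b) - corner_sum A a b = 0 \<or> corner_sum A a (Suc b) - corner_sum A a b = 1"
    if "a \<le> n" "b < n" for a b
    using A that unfolding ASM_iff_corner_sum by simp
  have last: "corner_sum A a n = int a" "corner_sum A n a = int a" if "a \<le> n" for a
    using A that unfolding ASM_iff_corner_sum by auto
  \<comment> \<open>Rows \<open>p\<close> and \<open>i + 1\<close> of \<open>A\<close> differ by
    \<open>0\<close>, \<open>1\<close> or \<open>2\<close>; the minimum lies at most
    \<open>1\<close> above the former and at most \<open>1\<close> below the latter.\<close>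
  have "r (Suc a) b - r a b \<in> {0, 1}" if "a < n" "b \<le> n" for a b
    using step[of a b] step[of p b] step[of i b] that p by (auto simp: r_def min_def)
  \<comment> \<open>The minimum of two integer sequences with steps in \<open>{0, 1}\<close> has
    steps in \<open>{0, 1}\<close>.\<close>
  moreover have "r a (Suc b) - r a b \<in> {0, 1}" if "a \<le> n" "b < n" for a b
    using step'[of a b] step'[of p b] step'[of "i + 1" b] that p
    by (auto simp: r_def min_def)
  moreover have "r a n = int a" "r n a = int a" if "a \<le> n" for a
    using that p by (auto simp: r_def last min_def)
  ultimately have "M \<in> ASM n"
    unfolding ASM_iff_corner_sum by (simp add: M) (simp add: M_def)
  then have fib: "M \<in> asm_fibre n i A"
    by (auto simp: asm_fibre_def M r_def)
  have min: "strong_le n M C" if "C \<in> asm_fibre n i A" for C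
    unfolding strong_le_def
  proof (intro ballI)
    fix a b assume ab: "a \<in> {1..n}" "b \<in> {1..n}"
    have C: "C \<in> ASM n" and
      eq: "\<And>a. a \<in> {1..n} \<Longrightarrow> a \<noteq> i \<Longrightarrow> corner_sum C a b = corner_sum A a b"
      using that ab by (auto simp: asm_fibre_def)
    have stepC: "corner_sum C (Suc a) b - corner_sum C a b \<in> {0, 1}" if "a < n" for a
      using C that ab unfolding ASM_iff_corner_sum by simp
    \<comment> \<open>The fibre fixes rows from \<open>1\<close> on only; if \<open>p = 0\<close>,
      both sides vanish.\<close>
    have "corner_sum C p b = corner_sum A p b"
      using eq[of p] p by (cases "p = 0") auto
    moreover have "corner_sum C (i + 1) b = corner_sum A (i + 1) b"
      using eq[of "i + 1"] p by auto
    ultimately show "corner_sum C a b \<le> corner_sum M a b"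
      using stepC[of p] stepC[of i] eq[of a] ab p by (auto simp: M r_def)
  qed
  have "asm_pi n i A = M"
    unfolding asm_pi_def
  proof (rule the_equality)
    \<comment> \<open>Two minima bound each other, hence have equal corner sums, and these determine
      the matrix.\<close>
    fix B assume B: "B \<in> asm_fibre n i A \<and> (\<forall>C\<in>asm_fibre n i A. strong_le n B C)"
    with fib min have "strong_le n B M" "strong_le n M B" by auto
    then have "corner_sum B a b = corner_sum M a b" if "a \<in> {1..n}" "b \<in> {1..n}" for a b
      using that unfolding strong_le_def by (metis order_antisym)
    moreover have "B \<in> carrier_mat n n" "M \<in> carrier_mat n n"
      using B \<open>M \<in> ASM n\<close> by (auto simp: asm_fibre_def ASM_def)
    ultimately show "B = M"
      by (intro eq_mat_if_corner_sum_eq)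
  qed (use fib min in auto)
  then show ?thesis
    using assms(3,4) by (simp add: M r_def)
qed

text \<open>The minimum in the formula for row \<open>i\<close> is monotone in both
  arguments.\<close>

lemma asm_pi_mono:
  assumes A: "A \<in> ASM n" and B: "B \<in> ASM n" and i: "i \<in> {1..n-1}" and le: "strong_le n A B"
  shows "strong_le n (asm_pi n i A) (asm_pi n i B)"
  unfolding strong_le_def
proof (intro ballI)
  fix a b assume ab: "a \<in> {1..n}" "b \<in> {1..n}"
  \<comment> \<open>Row \<open>0\<close> is included because \<open>i - 1\<close> is
    \<open>0\<close> when \<open>i = 1\<close>.\<close>
  have le': "corner_sum B a b \<le> corner_sum A a b" if "a \<le> n" for a
    using le ab that by (cases "a = 0") (auto simp: strong_le_def)
  have "corner_sum B (i - 1) b \<le> corner_sum A (i - 1) b"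
       "corner_sum B (i + 1) b \<le> corner_sum A (i + 1) b" "corner_sum B a b \<le> corner_sum A a b"
    using le'[of "i - 1"] le'[of "i + 1"] le'[of a] ab i by auto
  then show "corner_sum (asm_pi n i B) a b \<le> corner_sum (asm_pi n i A) a b"
    using ab by (auto simp: asm_pi_corner_sum[OF A i] asm_pi_corner_sum[OF B i] min_def)
qed

section \<open>Deleting rows and columns of a submatrix\<close>

lemma pick_delete:
  assumes "l < card C" "b < card C - 1"
  shows "pick (C - {pick C l}) b = pick C (if b < l then b else Suc b)"
proof -
  define b' where "b' = (if b < l then b else Suc b)"
  have b': "b' < card C" "b' \<noteq> l" using assms by (auto simp: b'_def)
  have fin: "finite C" using assms by (metis card.infinite less_nat_zero_code)
  have lt: "pick C l < pick C b' \<longleftrightarrow> l < b'" "pick C l \<noteq> pick C b'"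
    using pick_mono_le[OF assms(1), of b'] pick_mono_le[OF b'(1), of l] b'(2)
    by (metis linorder_neqE_nat not_less_iff_gr_or_eq)+
  \<comment> \<open>An element is located by counting the smaller ones; removing
    \<open>pick C l\<close> lowers this count exactly for indices beyond \<open>l\<close>.\<close>
  have "{a \<in> C - {pick C l}. a < pick C b'} = {a \<in> C. a < pick C b'} - {pick C l}"
    by auto
  then have "card {a \<in> C - {pick C l}. a < pick C b'} = (if l < b' then b' - 1 else b')"
    using card_pick_le[OF b'(1)] pick_in_set_le[OF assms(1)] lt fin by (simp add: card_Diff_singleton_if)
  also have "\<dots> = b" by (auto simp: b'_def)
  finally show ?thesis
    using pick_card_in_set[of "pick C b'" "C - {pick C l}"] pick_in_set_le[OF b'(1)] lt(2)
    by (simp add: b'_def)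
qed

lemma pick_atLeastLessThan: "t < m \<Longrightarrow> pick {a..<a + m} t = a + t"
proof -
  assume t: "t < m"
  then have "{x \<in> {a..<a + m}. x < a + t} = {a..<a + t}" by auto
  then show ?thesis
    using pick_card_in_set[of "a + t" "{a..<a + m}"] t by simp
qed

lemma submatrix_carrier:
  assumes "M \<in> carrier_mat m n" "R \<subseteq> {..<m}" "C \<subseteq> {..<n}"
  shows "submatrix M R C \<in> carrier_mat (card R) (card C)"
    and "\<And>s t. s < card R \<Longrightarrow> t < card C \<Longrightarrow> submatrix M R C $$ (s, t) = M $$ (pick R s, pick C t)"
proof -
  have *: "{i. i < dim_row M \<and> i \<in> R} = R" "{i. i < dim_col M \<and> i \<in> C} = C"
    using assms by auto
  show "submatrix M R C \<in> carrier_mat (card R) (card C)"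
    unfolding carrier_mat_def mem_Collect_eq dim_submatrix * by simp
  show "submatrix M R C $$ (s, t) = M $$ (pick R s, pick C t)" if "s < card R" "t < card C" for s t
    by (rule submatrix_index) (simp_all add: * that)
qed

text \<open>Deletion only shrinks the index sets; this keeps the cofactors of a Laplace expansion
  among the minors.\<close>

lemma mat_delete_submatrix:
  assumes M: "M \<in> carrier_mat m n" "R \<subseteq> {..<m}" "C \<subseteq> {..<n}" and k: "k < card R" and l: "l < card C"
  shows "mat_delete (submatrix M R C) k l = submatrix M (R - {pick R k}) (C - {pick C l})"
proof -
  have card: "card (R - {pick R k}) = card R - 1" "card (C - {pick C l}) = card C - 1"
    using pick_in_set_le[OF k] pick_in_set_le[OF l] by (simp_all add: card_Diff_singleton)
  have M': "R - {pick R k} \<subseteq> {..<m}" "C - {pick C l} \<subseteq> {..<n}" using M by auto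
  note sub = submatrix_carrier[OF M] and sub' = submatrix_carrier[OF M(1) M']
  show ?thesis
  proof (rule eq_matI)
    fix s t assume "s < dim_row (submatrix M (R - {pick R k}) (C - {pick C l}))"
      "t < dim_col (submatrix M (R - {pick R k}) (C - {pick C l}))"
    then have st: "s < card R - 1" "t < card C - 1" using sub'(1) card by auto
    then show "mat_delete (submatrix M R C) k l $$ (s, t) =
        submatrix M (R - {pick R k}) (C - {pick C l}) $$ (s, t)"
      using sub(1) by (simp add: mat_delete_def sub' card sub(2) pick_delete[OF k] pick_delete[OF l])
  qed (use sub(1) sub'(1) card in auto)
qed

lemma set_sum_mono:
  fixes f g :: "'a \<Rightarrow> 'b::comm_monoid_add set"
  assumes "\<And>x. x \<in> X \<Longrightarrow> f x \<subseteq> g x"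
  shows "sum f X \<subseteq> sum g X"
  using assms by (induction X rule: infinite_finite_induct) (simp_all add: set_plus_mono2)

section \<open>Monomial supports in the polynomial ring\<close>

lemma generic_matrix_index: "a < n \<Longrightarrow> b < n \<Longrightarrow> generic_matrix n $$ (a, b) = zvar a b"
  by (simp add: generic_matrix_def)

text \<open>
  The kernel of the map which sends the variables outside \<open>P\<close> to 0.
\<close>

definition monomials_off :: "nat \<Rightarrow> (nat \<times> nat) set \<Rightarrow> 'k::field zpoly set" where
  "monomials_off n P = {p \<in> carrier (generic_ring n). \<forall>m \<in> Poly_Mapping.keys p. \<not> Poly_Mapping.keys m \<subseteq> P}"

lemma keys_subset_add:
  fixes a b :: "'a \<Rightarrow>\<^sub>0 nat"
  shows "Poly_Mapping.keys a \<subseteq> Poly_Mapping.keys (a + b)"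
  by (auto simp: in_keys_iff lookup_add)

text \<open>The exponent vector of the Leibniz term belonging to the permutation
  \<open>p\<close>.\<close>

definition minor_monomial :: "nat set \<Rightarrow> nat set \<Rightarrow> (nat \<Rightarrow> nat) \<Rightarrow> (nat \<times> nat) \<Rightarrow>\<^sub>0 nat" where
  "minor_monomial R C p = (\<Sum>t<card R. Poly_Mapping.single (pick R t, pick C (p t)) 1)"

lemma keys_minor_monomial:
  "Poly_Mapping.keys (minor_monomial R C p) = (\<lambda>t. (pick R t, pick C (p t))) ` {..<card R}"
proof -
  have "Poly_Mapping.keys (\<Sum>t<k. Poly_Mapping.single (f t) (1::nat)) = f ` {..<k}"
    for k and f :: "nat \<Rightarrow> nat \<times> nat"
    by (induction k)
      (auto simp: in_keys_iff lookup_add lookup_single when_def lessThan_Suc set_eq_iff)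
  then show ?thesis by (simp add: minor_monomial_def)
qed

context
  fixes n :: nat
begin

interpretation R: cring "generic_ring n :: 'k::field zpoly ring"
  by (rule generic_ring_cring)

lemma generic_ring_ops [simp]:
  "x \<oplus>\<^bsub>generic_ring n\<^esub> y = x + y" "x \<otimes>\<^bsub>generic_ring n\<^esub> y = x * y"
  "\<zero>\<^bsub>generic_ring n\<^esub> = (0 :: 'k::field zpoly)" "\<one>\<^bsub>generic_ring n\<^esub> = (1 :: 'k zpoly)"
  by (simp_all add: generic_ring_def)

lemma mem_generic_ring_iff:
  "p \<in> carrier (generic_ring n :: 'k::field zpoly ring) \<longleftrightarrow>
     (\<forall>m \<in> Poly_Mapping.keys p. Poly_Mapping.keys m \<subseteq> {..<n} \<times> {..<n})"
  by (simp add: generic_ring_def)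

lemma ideal_generic_ring_sum:
  assumes "ideal I (generic_ring n :: 'k::field zpoly ring)" "\<And>x. x \<in> X \<Longrightarrow> f x \<in> I"
  shows "sum f X \<in> I"
proof -
  interpret I: ideal I "generic_ring n :: 'k zpoly ring" by fact
  show ?thesis
    using assms(2) I.zero_closed I.a_closed by (induction X rule: infinite_finite_induct) simp_all
qed

text \<open>Exponents are natural numbers, so multiplication only enlarges the support of a
  monomial: one that leaves \<open>P\<close> never returns.\<close>

lemma ideal_monomials_off: "ideal (monomials_off n P) (generic_ring n :: 'k::field zpoly ring)"
proof (rule idealI)
  have plus: "x + y \<in> monomials_off n P" if "x \<in> monomials_off n P" "y \<in> monomials_off n P" for x y :: "'k zpoly"
    using that Poly_Mapping.keys_add[of x y] by (fastforce simp: monomials_off_def mem_generic_ring_iff)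
  have uminus: "- x \<in> monomials_off n P" if "x \<in> monomials_off n P" for x :: "'k zpoly"
    using that by (simp add: monomials_off_def mem_generic_ring_iff)
  have "\<ominus>\<^bsub>generic_ring n\<^esub> x = - x" if "x \<in> monomials_off n P" for x :: "'k zpoly"
    using that uminus[OF that] by (intro R.minus_equality) (simp_all add: monomials_off_def)
  then have "\<ominus>\<^bsub>generic_ring n\<^esub> x \<in> monomials_off n P" if "x \<in> monomials_off n P" for x :: "'k zpoly"
    using that uminus by simp
  moreover have "monomials_off n P \<subseteq> carrier (generic_ring n :: 'k zpoly ring)"
      and "(0 :: 'k zpoly) \<in> monomials_off n P"
    by (auto simp: monomials_off_def mem_generic_ring_iff)
  ultimately show "subgroup (monomials_off n P) (add_monoid (generic_ring n :: 'k zpoly ring))"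
    using plus by (intro subgroup.intro) (simp_all add: a_inv_def)
  have times: "x * a \<in> monomials_off n P"
    if "a \<in> monomials_off n P" "x \<in> carrier (generic_ring n)" for a x :: "'k zpoly"
  proof -
    have "\<not> Poly_Mapping.keys m \<subseteq> P" if m: "m \<in> Poly_Mapping.keys (x * a)" for m
    proof -
      obtain u v where "m = v + u" "v \<in> Poly_Mapping.keys a"
        using keys_mult[of x a] m by (auto simp: add.commute)
      then show ?thesis
        using \<open>a \<in> monomials_off n P\<close> keys_subset_add[of v u] by (auto simp: monomials_off_def)
    qed
    moreover have "x * a \<in> carrier (generic_ring n)"
      using R.m_closed[of x a] that by (simp add: monomials_off_def)
    ultimately show ?thesis by (simp add: monomials_off_def)
  qed
  show "x \<otimes>\<^bsub>generic_ring n\<^esub> a \<in> monomials_off n P" "a \<otimes>\<^bsub>generic_ring n\<^esub> x \<in> monomials_off n P"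
    if "a \<in> monomials_off n P" "x \<in> carrier (generic_ring n)" for a x :: "'k zpoly"
    using times[OF that] by (simp_all add: mult.commute)
qed (rule R.ring_axioms)

section \<open>Minors as polynomials and the ideals they generate\<close>

lemma minor_expansion:
  assumes "R \<subseteq> {..<n}" "C \<subseteq> {..<n}" "card R = k" "card C = k"
  shows "det (submatrix (generic_matrix n :: 'k::field zpoly mat) R C) =
    (\<Sum>p | p permutes {0..<k}. Poly_Mapping.single (minor_monomial R C p) (signof p))"
proof -
  have Z: "(generic_matrix n :: 'k zpoly mat) \<in> carrier_mat n n" by (simp add: generic_matrix_def)
  note sub = submatrix_carrier[OF Z assms(1,2), unfolded assms(3,4)]
  have pick: "pick R t < n" "pick C t < n" if "t < k" for t
    using pick_in_set_le[of t R] pick_in_set_le[of t C] assms that by auto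
  \<comment> \<open>A product of variables is a single monomial, so each Leibniz term contributes
    one monomial.\<close>
  have prod: "(\<Prod>t<m. Poly_Mapping.single (f t) (1::'k)) = Poly_Mapping.single (\<Sum>t<m. f t) 1"
    for m and f :: "nat \<Rightarrow> (nat \<times> nat) \<Rightarrow>\<^sub>0 nat"
    by (induction m) (simp_all add: mult_single)
  show ?thesis
    unfolding det_def'[OF sub(1)]
  proof (rule sum.cong[OF refl], unfold mem_Collect_eq)
    fix p assume p: "p permutes {0..<k}"
    then have lt: "p t < k" if "t < k" for t
      using that permutes_in_image[OF p, of t] by simp
    have "(\<Prod>t = 0..<k. submatrix (generic_matrix n :: 'k zpoly mat) R C $$ (t, p t)) =
        (\<Prod>t<k. Poly_Mapping.single (Poly_Mapping.single (pick R t, pick C (p t)) 1) 1)"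
      by (rule prod.cong) (auto simp: sub(2) lt pick generic_matrix_index zvar_def)
    also have "\<dots> = Poly_Mapping.single (minor_monomial R C p) 1"
      by (simp add: prod minor_monomial_def assms)
    finally show "signof p * (\<Prod>t = 0..<k. submatrix (generic_matrix n :: 'k zpoly mat) R C $$ (t, p t)) =
        Poly_Mapping.single (minor_monomial R C p) (signof p)"
      \<comment> \<open>On the left the sign is a polynomial, on the right a coefficient in the
        field.\<close>
      by (cases p rule: sign_cases) (simp_all add: single_uminus)
  qed
qed

lemma minor_closed:
  assumes "R \<subseteq> {..<n}" "C \<subseteq> {..<n}" "card R = card C"
  shows "det (submatrix (generic_matrix n) R C) \<in> carrier (generic_ring n :: 'k::field zpoly ring)"
proof -
  have "pick R t < n" if "t < card R" for t
    using pick_in_set_le[OF that] assms by auto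
  moreover have "pick C (p t) < n" if "t < card R" "p permutes {0..<card R}" for p t
    using pick_in_set_le[of "p t" C] permutes_in_image[OF that(2), of t] that assms by auto
  ultimately have "Poly_Mapping.keys (minor_monomial R C p) \<subseteq> {..<n} \<times> {..<n}"
    if "p permutes {0..<card R}" for p
    using that by (auto simp: keys_minor_monomial)
  then show ?thesis
    unfolding minor_expansion[OF assms(1,2) refl assms(3)[symmetric]]
    \<comment> \<open>The ring is an ideal of itself, which gives closure under finite sums.\<close>
    by (intro ideal_generic_ring_sum[OF R.oneideal]) (simp add: mem_generic_ring_iff)
qed

lemma corner_minors_closed:
  assumes "i \<le> n" "j \<le> n"
  shows "corner_minors n k i j \<subseteq> carrier (generic_ring n :: 'k::field zpoly ring)"
proof
  fix x :: "'k zpoly" assume "x \<in> corner_minors n k i j"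
  then obtain R C where "x = det (submatrix (generic_matrix n) R C)" "R \<subseteq> {..<i}" "C \<subseteq> {..<j}"
    "card R = card C"
    unfolding corner_minors_def by auto
  then show "x \<in> carrier (generic_ring n)"
    using assms minor_closed[of R C] by fastforce
qed

text \<open>Expanding along the first row leaves, up to sign, minors of size \<open>k\<close> on
  subsets of the same rows and columns.\<close>

lemma corner_minors_Suc_subset:
  assumes "i \<le> n" "j \<le> n"
  shows "corner_minors n (Suc k) i j \<subseteq>
    (genideal (generic_ring n) (corner_minors n k i j) :: 'k::field zpoly set)"
proof
  let ?Z = "generic_matrix n :: 'k zpoly mat"
  let ?I = "genideal (generic_ring n) (corner_minors n k i j) :: 'k zpoly set"
  have Z: "?Z \<in> carrier_mat n n" by (simp add: generic_matrix_def)
  interpret I: ideal ?I "generic_ring n :: 'k zpoly ring"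
    by (rule R.genideal_ideal[OF corner_minors_closed[OF assms]])
  fix x :: "'k zpoly" assume "x \<in> corner_minors n (Suc k) i j"
  then obtain R C where x: "x = det (submatrix ?Z R C)" and RC: "R \<subseteq> {..<i}" "C \<subseteq> {..<j}"
    and card: "card R = Suc k" "card C = Suc k"
    unfolding corner_minors_def by auto
  have RC': "R \<subseteq> {..<n}" "C \<subseteq> {..<n}" using RC assms by auto
  note sub = submatrix_carrier[OF Z RC', unfolded card]
  have "submatrix ?Z R C $$ (0, l) * cofactor (submatrix ?Z R C) 0 l \<in> ?I" if l: "l < Suc k" for l
  proof -
    have pick: "pick R 0 \<in> R" "pick C l \<in> C"
      using pick_in_set_le[of 0 R] pick_in_set_le[of l C] card l by auto
    have "det (mat_delete (submatrix ?Z R C) 0 l) \<in> corner_minors n k i j"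
      using RC card pick l
      unfolding mat_delete_submatrix[OF Z RC', of 0 l, unfolded card, OF zero_less_Suc l] corner_minors_def
      by (intro CollectI exI[of _ "R - {pick R 0}"] exI[of _ "C - {pick C l}"])
        (auto simp: card_Diff_singleton)
    then have D: "det (mat_delete (submatrix ?Z R C) 0 l) \<in> ?I"
      using R.genideal_self[OF corner_minors_closed[OF assms]] by blast
    have "pick R 0 < n" "pick C l < n"
      using pick RC' by auto
    \<comment> \<open>The cofactor sign is moved to the matrix entry, so that the other factor is a
      plain minor.\<close>
    then have "submatrix ?Z R C $$ (0, l) * (- 1) ^ (0 + l) \<in> carrier (generic_ring n)"
      using l by (cases "even l") (auto simp: sub(2) generic_matrix_index zvar_def mem_generic_ring_iff)
    from I.I_l_closed[OF D this] show ?thesis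
      by (simp add: cofactor_def mult.assoc)
  qed
  then show "x \<in> ?I"
    unfolding x laplace_expansion_row[OF sub(1) zero_less_Suc]
    by (intro ideal_generic_ring_sum[OF I.ideal_axioms]) auto
qed

lemma corner_minors_ideal_mono:
  assumes "i \<le> n" "j \<le> n" "k \<le> k'"
  shows "genideal (generic_ring n) (corner_minors n k' i j) \<subseteq>
    (genideal (generic_ring n) (corner_minors n k i j) :: 'k::field zpoly set)"
  using \<open>k \<le> k'\<close>
proof (induction rule: dec_induct)
  case (step m)
  have "genideal (generic_ring n) (corner_minors n (Suc m) i j) \<subseteq>
    (genideal (generic_ring n) (corner_minors n m i j) :: 'k zpoly set)"
    by (intro R.genideal_minimal R.genideal_ideal corner_minors_closed corner_minors_Suc_subset assms)
  with step.IH show ?case by blast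
qed simp

text \<open>Smaller corner sums mean generators of smaller size, so the inclusion holds summand by
  summand.\<close>

lemma asm_ideal_mono:
  assumes "strong_le n A B"
  shows "(asm_ideal n A :: 'k::field zpoly set) \<subseteq> asm_ideal n B"
  unfolding asm_ideal_def
proof (rule set_sum_mono)
  let ?G = "\<lambda>A (i, j).
    (genideal (generic_ring n) (corner_minors n (nat (corner_sum A i j) + 1) i j) :: 'k zpoly set)"
  fix ij assume "ij \<in> {1..n} \<times> {1..n}"
  then obtain i j where ij: "ij = (i, j)" "i \<in> {1..n}" "j \<in> {1..n}" by auto
  then have "nat (corner_sum B i j) + 1 \<le> nat (corner_sum A i j) + 1"
    using assms by (simp add: strong_le_def nat_mono)
  then show "?G A ij \<subseteq> ?G B ij"
    unfolding ij(1) prod.case using ij by (intro corner_minors_ideal_mono) simp_all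
qed

section \<open>Setting the variables off an antidiagonal to zero\<close>

text \<open>
  For \<open>k \<le> i\<close> and \<open>k \<le> j\<close>, the antidiagonal of the block with rows \<open>{i - k..<i}\<close> and columns
  \<open>{j - k..<j}\<close>.
\<close>

definition antidiagonal :: "nat \<Rightarrow> nat \<Rightarrow> nat \<Rightarrow> (nat \<times> nat) set" where
  "antidiagonal k i j = {(u, v). u < i \<and> v < j \<and> u + v + k + 1 = i + j}"

text \<open>At most \<open>k - (i - a) - (j - b)\<close> antidiagonal positions survive the cut to
  the first \<open>a\<close> rows and \<open>b\<close> columns, whereas a Leibniz term of size
  \<open>s\<close> would need \<open>s\<close> of them in distinct rows.\<close>

lemma corner_minors_monomials_off_antidiagonal:
  assumes "a \<le> n" "b \<le> n" and s: "k - (i - a) - (j - b) < s" and k: "k \<le> i" "k \<le> j"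
  shows "corner_minors n s a b \<subseteq> (monomials_off n (antidiagonal k i j) :: 'k::field zpoly set)"
proof
  fix x :: "'k zpoly" assume x_in: "x \<in> corner_minors n s a b"
  then obtain R C where x: "x = det (submatrix (generic_matrix n) R C)"
    and RC: "R \<subseteq> {..<a}" "C \<subseteq> {..<b}" and card: "card R = s" "card C = s"
    unfolding corner_minors_def by auto
  have RC': "R \<subseteq> {..<n}" "C \<subseteq> {..<n}" using RC assms by auto
  have off: "\<not> Poly_Mapping.keys (minor_monomial R C p) \<subseteq> antidiagonal k i j"
    if p: "p permutes {0..<s}" for p
  proof
    assume *: "Poly_Mapping.keys (minor_monomial R C p) \<subseteq> antidiagonal k i j"
    \<comment> \<open>Since \<open>u + v\<close> is constant on the antidiagonal, the upper bound on
      the column \<open>v\<close> is a lower bound on the row \<open>u\<close>.\<close>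
    have "R \<subseteq> {i + j - k - min b j..<min a i}"
    proof
      fix u assume u: "u \<in> R"
      define t where "t = card {a \<in> R. a < u}"
      have "finite R" using RC(1) finite_subset by blast
      then have "t < card R"
        unfolding t_def by (rule psubset_card_mono) (use u in blast)
      with u have t: "t < s" "pick R t = u"
        by (simp_all add: card t_def pick_card_in_set)
      define v where "v = pick C (p t)"
      have "(pick R t, pick C (p t)) \<in> antidiagonal k i j"
        using * t(1) unfolding keys_minor_monomial card image_subset_iff by simp
      then have "u < i" "v < j" "u + v + k + 1 = i + j"
        by (simp_all add: antidiagonal_def t(2) v_def)
      moreover have "v \<in> C"
        unfolding v_def using permutes_in_image[OF p, of t] t(1) by (intro pick_in_set_le) (simp add: card)
      then have "v < b" using RC by auto
      moreover have "u < a" using u RC by auto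
      ultimately show "u \<in> {i + j - k - min b j..<min a i}"
        unfolding atLeastLessThan_iff by linarith
    qed
    then have "s \<le> min a i - (i + j - k - min b j)"
      using card_mono[of "{i + j - k - min b j..<min a i}" R] card by simp
    then show False using s k by linarith
  qed
  have "Poly_Mapping.keys x \<subseteq> (\<Union>p \<in> {p. p permutes {0..<s}}. {minor_monomial R C p})"
    unfolding x minor_expansion[OF RC' card]
    by (rule order_trans[OF Poly_Mapping.keys_sum]) (intro UN_mono, auto)
  with off have "\<not> Poly_Mapping.keys m \<subseteq> antidiagonal k i j" if "m \<in> Poly_Mapping.keys x" for m
    using that by blast
  moreover have "x \<in> carrier (generic_ring n)"
    using x_in corner_minors_closed[OF assms(1,2)] by (rule rev_subsetD)
  ultimately show "x \<in> monomials_off n (antidiagonal k i j)"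
    by (simp add: monomials_off_def)
qed

text \<open>The reversing permutation gives a monomial supported on the antidiagonal; no other
  permutation gives the same one, so nothing cancels it.\<close>

lemma antidiagonal_minor_not_monomials_off:
  assumes k: "k \<le> i" "k \<le> j" and "i \<le> n" "j \<le> n"
  shows "det (submatrix (generic_matrix n) {i - k..<i} {j - k..<j}) \<notin>
    (monomials_off n (antidiagonal k i j) :: 'k::field zpoly set)"
proof -
  \<comment> \<open>Reversal of \<open>{0..<k}\<close>, extended by the identity as
    \<open>permutes\<close> demands; it is its own inverse.\<close>
  define q where "q t = (if t < k then k - 1 - t else t)" for t
  let ?R = "{i - k..<i}" and ?C = "{j - k..<j}"
  let ?d = "det (submatrix (generic_matrix n) ?R ?C) :: 'k zpoly"
  have q: "q permutes {0..<k}"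
    by (rule bij_imp_permutes, rule bij_betw_byWitness[where f' = q]) (auto simp: q_def)
  have keys: "Poly_Mapping.keys (minor_monomial ?R ?C p) = (\<lambda>t. (i - k + t, j - k + p t)) ` {..<k}"
    if p: "p permutes {0..<k}" for p
  proof -
    have "(pick ?R t, pick ?C (p t)) = (i - k + t, j - k + p t)" if "t < k" for t
      using pick_atLeastLessThan[of t k "i - k"] pick_atLeastLessThan[of "p t" k "j - k"]
        permutes_in_image[OF p, of t] that k by simp
    then show ?thesis
      using k by (auto simp: keys_minor_monomial)
  qed
  have qP: "Poly_Mapping.keys (minor_monomial ?R ?C q) \<subseteq> antidiagonal k i j"
    unfolding keys[OF q] using k by (auto simp: antidiagonal_def q_def)
  have uniq: "p = q" if p: "p permutes {0..<k}" and eq: "minor_monomial ?R ?C p = minor_monomial ?R ?C q" for p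
  proof
    fix t
    show "p t = q t"
    proof (cases "t < k")
      case True
      then have "(i - k + t, j - k + p t) \<in> antidiagonal k i j"
        using qP keys[OF p] eq by auto
      then show ?thesis using True k by (auto simp: antidiagonal_def q_def)
    next
      case False
      then show ?thesis using permutes_not_in[OF p, of t] by (simp add: q_def)
    qed
  qed
  have RC: "?R \<subseteq> {..<n}" "?C \<subseteq> {..<n}" "card ?R = k" "card ?C = k"
    using assms by auto
  have "Poly_Mapping.lookup ?d (minor_monomial ?R ?C q) =
      (\<Sum>p | p permutes {0..<k}. if p = q then signof p else 0)"
    unfolding minor_expansion[OF RC] lookup_sum
    by (rule sum.cong) (auto simp: lookup_single when_def dest: uniq)
  also have "\<dots> = signof q"
    using q by (simp add: finite_permutations)
  also have "\<dots> \<noteq> 0"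
    \<comment> \<open>The coefficient is \<open>1\<close> or \<open>-1\<close>, nonzero in every
      characteristic.\<close>
    by (cases q rule: sign_cases) simp_all
  finally show ?thesis
    using qP by (auto simp: monomials_off_def in_keys_iff)
qed

section \<open>From inclusion of ideals back to strong order\<close>

lemma asm_ideal_subset:
  assumes "ideal I (generic_ring n :: 'k::field zpoly ring)"
    and "\<And>a b. a \<in> {1..n} \<Longrightarrow> b \<in> {1..n} \<Longrightarrow> corner_minors n (nat (corner_sum B a b) + 1) a b \<subseteq> I"
  shows "asm_ideal n B \<subseteq> I"
proof -
  let ?G = "\<lambda>(a, b). genideal (generic_ring n) (corner_minors n (nat (corner_sum B a b) + 1) a b)"
  have G: "?G ab \<subseteq> I" if "ab \<in> {1..n} \<times> {1..n}" for ab
  proof -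
    obtain a b where ab: "ab = (a, b)" "a \<in> {1..n}" "b \<in> {1..n}" using \<open>ab \<in> _\<close> by auto
    show ?thesis
      unfolding ab(1) prod.case by (intro R.genideal_minimal assms ab)
  qed
  \<comment> \<open>Elements of a sum of sets are sums of one chosen element \<open>s ab\<close> per
    summand, and an ideal is closed under these.\<close>
  have "sum s ({1..n} \<times> {1..n}) \<in> I" if "\<forall>ab \<in> {1..n} \<times> {1..n}. s ab \<in> ?G ab" for s
  proof (rule ideal_generic_ring_sum[OF assms(1)])
    fix ab assume "ab \<in> {1..n} \<times> {1..n}"
    then show "s ab \<in> I" using that G[of ab] by (meson subsetD)
  qed
  then show ?thesis
    unfolding asm_ideal_def by (subst set_sum_alt) (simp, rule subsetI, elim CollectE exE conjE, simp)
qed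

lemma corner_minors_subset_asm_ideal:
  assumes "i \<in> {1..n}" "j \<in> {1..n}"
  shows "corner_minors n (nat (corner_sum A i j) + 1) i j \<subseteq> (asm_ideal n A :: 'k::field zpoly set)"
proof
  let ?G = "\<lambda>(i, j). genideal (generic_ring n) (corner_minors n (nat (corner_sum A i j) + 1) i j) :: 'k zpoly set"
  fix x :: "'k zpoly" assume x: "x \<in> corner_minors n (nat (corner_sum A i j) + 1) i j"
  \<comment> \<open>The choice taking \<open>x\<close> from the summand at \<open>(i, j)\<close> and
    \<open>0\<close> from all others.\<close>
  define f where "f = (\<lambda>ab. if ab = (i, j) then x else 0)"
  have "f ab \<in> ?G ab" if "ab \<in> {1..n} \<times> {1..n}" for ab
  proof -
    obtain a b where ab: "ab = (a, b)" "a \<le> n" "b \<le> n" using \<open>ab \<in> _\<close> by auto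
    note closed = corner_minors_closed[OF ab(2,3)]
    interpret I: ideal "genideal (generic_ring n) (corner_minors n (nat (corner_sum A a b) + 1) a b)"
        "generic_ring n :: 'k zpoly ring"
      by (rule R.genideal_ideal[OF closed])
    show ?thesis
      using x R.genideal_self[OF closed] I.zero_closed by (auto simp: f_def ab(1))
  qed
  then have "\<forall>ab \<in> {1..n} \<times> {1..n}. f ab \<in> ?G ab" ..
  moreover have "sum f ({1..n} \<times> {1..n}) = x"
    using assms by (simp add: f_def)
  ultimately show "x \<in> asm_ideal n A"
    unfolding asm_ideal_def by (subst set_sum_alt) (simp, intro CollectI exI[of _ f], simp)
qed

lemma strong_le_if_asm_ideal_subset:
  assumes A: "A \<in> ASM n" and B: "B \<in> ASM n"
    and sub: "(asm_ideal n A :: 'k::field zpoly set) \<subseteq> asm_ideal n B"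
  shows "strong_le n A B"
proof (rule ccontr)
  assume "\<not> strong_le n A B"
  then obtain i j where ij: "i \<in> {1..n}" "j \<in> {1..n}" and less: "corner_sum A i j < corner_sum B i j"
    by (auto simp: strong_le_def not_le)
  \<comment> \<open>The size of the minors that \<open>A\<close> contributes at
    \<open>(i, j)\<close>; the failing inequality makes it at most the corner sum of
    \<open>B\<close> there.\<close>
  define k where "k = nat (corner_sum A i j) + 1"
  have ij_n: "i \<le> n" "j \<le> n" using ij by auto
  have "0 \<le> corner_sum A i j"
    using corner_sum_lipschitz[OF A, of 0 j i j] ij by simp
  then have kB: "int k \<le> corner_sum B i j"
    using less by (simp add: k_def)
  \<comment> \<open>Comparing with row \<open>0\<close> and column \<open>0\<close> shows that the
    \<open>k\<close> by \<open>k\<close> block fits into the corner.\<close>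
  then have k: "k \<le> i" "k \<le> j"
    using corner_sum_lipschitz[OF B, of i j 0 j] corner_sum_lipschitz[OF B, of i j i 0] ij by simp_all
  let ?K = "monomials_off n (antidiagonal k i j) :: 'k zpoly set"
  let ?d = "det (submatrix (generic_matrix n) {i - k..<i} {j - k..<j}) :: 'k zpoly"
  have "{i - k..<i} \<subseteq> {..<i}" "{j - k..<j} \<subseteq> {..<j}" "card {i - k..<i} = k" "card {j - k..<j} = k"
    using k by auto
  then have "?d \<in> corner_minors n k i j"
    unfolding corner_minors_def by blast
  then have "?d \<in> asm_ideal n A"
    using corner_minors_subset_asm_ideal[OF ij, of A] by (auto simp: k_def)
  moreover have "asm_ideal n B \<subseteq> ?K"
  proof (rule asm_ideal_subset[OF ideal_monomials_off])
    fix a b assume "a \<in> {1..n}" "b \<in> {1..n}"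
    then have ab: "a \<le> n" "b \<le> n" by auto
    \<comment> \<open>The Lipschitz bound carries \<open>k \<le> corner_sum B i j\<close> from
      \<open>(i, j)\<close> to \<open>(a, b)\<close>.\<close>
    have "k - (i - a) - (j - b) < nat (corner_sum B a b) + 1"
      using corner_sum_lipschitz[OF B ij_n ab] kB by linarith
    then show "corner_minors n (nat (corner_sum B a b) + 1) a b \<subseteq> ?K"
      by (rule corner_minors_monomials_off_antidiagonal[OF ab _ k])
  qed
  ultimately show False
    using sub antidiagonal_minor_not_monomials_off[OF k ij_n, where ?'k = 'k] by blast
qed

end

theorem theorem3p6:
  fixes n i :: nat and A B :: "int mat"
  assumes "A \<in> ASM n" and "B \<in> ASM n" and "i \<in> {1..n-1}"
  shows "(strong_le n A B \<longrightarrow> strong_le n (asm_pi n i A) (asm_pi n i B)) \<and>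
    ((asm_ideal n A :: 'k::field zpoly set) \<subseteq> asm_ideal n B \<longrightarrow>
      (asm_ideal n (asm_pi n i A) :: 'k zpoly set) \<subseteq> asm_ideal n (asm_pi n i B))"
  \<comment> \<open>For the ideals: pass to strong order, apply monotonicity of
    \<open>asm_pi\<close> there, and return.\<close>
  using asm_pi_mono[OF assms] asm_ideal_mono strong_le_if_asm_ideal_subset[OF assms(1,2)] by blast

end
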